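(* Let $U_J(\beta_J(q),\bar a(\beta_J(q),q))$ be the stakeholder's equilibrium ex-ante expected payoff in Regime J when the private signal $s$ has informativeness $q$, and let $U_C(\beta_C,a_C)$ be the stakeholder's equilibrium ex-ante expected payoff in Regime C. Then: 1. When $s$ is uninformative, the stakeholder prefers Regime C over Regime J: $U_C(\beta_C,a_C)>U_J(\beta_J(0),\bar a(\beta_J(0),0))$. 2. The stakeholder prefers Regime J with a more informative $s$: $\dfrac{dU_J(\beta_J(q),\bar a(\beta_J(q),q))}{dq}>0$. 3. When $s$ is perfectly informative, the stakeholder prefers Regime J over Regime C: $U_C(\beta_C,a_C)<U_J(\beta_J(1),\bar a(\beta_J(1),1))$.
   Context: Model. A state $\theta\in\{G,B\}$ has $\Pr(\theta=G)=\Pr(\theta=B)=1/2$. A project costs $I$ and returns $X>0$ if $\theta=G$ and $0$ if $\theta=B$, with $X/2>I$. An auditor chooses effort $\beta$ at cost $\frac12k\beta^2$; a report $r\in\{g,b\}$ has $\Pr(r=g\mid G)=1$, $\Pr(r=g\mid B)=1-\beta$. If $r=b$ the project is not undertaken and there is no verification. If $r=g$, verification at level $a\in[0,1)$ costs the stakeholder $\frac12ca^2$ and identifies the state with probability $a$; if it reveals $B$, the auditor loses $L$ and the project is not undertaken; otherwise the project is undertaken and the auditor loses nothing. Gross of verification cost, the stakeholder gets $X-I$ if the project is undertaken in state $G$, $-I$ if undertaken in state $B$, and $0$ if it is not undertaken. Parameters satisfy $c>I>0$ and $k>L>0$; put $i=I/c$ and $l=L/k$. Private signal: $s$ has finite support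 (realizations $\omega_t$), is independent of $r$ conditional on $\theta$, and belongs to a continuous nested family of information structures $\{\pi_q\}_{q\in[0,1]}$: whenever $q'>q$, $\pi_{q'}$ strictly Blackwell dominates $\pi_q$; $\pi_0$ is uninformative, $\pi_1$ is perfectly informative, and the conditional signal distributions $\Pr_q(s=\omega_t\mid\theta)$ vary continuously in $q$. Regime J: the auditor chooses $\beta$ (unobserved); then the stakeholder observes $r$ and $s\sim\pi_q$ and, if $r=g$, chooses the verification level $a(s)$. Given anticipated effort $\beta$, his optimal choice is $a(\omega_t)=i\Pr(\theta=B\mid r=g,s=\omega_t)=i\frac{(1-\beta)\Pr_q(\omega_t\mid B)}{(1-\beta)\Pr_q(\omega_t\mid B)+\Pr_q(\omega_t\mid G)}$, and the critical verification level is $\bar a(\beta,q)=\sum_t\Pr_q(\omega_t\mid B)\,a(\omega_t)$ (sum over the support of $s$). In the unique equilibrium, the effort $\beta_J(q)$ is the unique $\beta\in[0,1)$ with $\beta=\frac l2\bar a(\beta,q)$. The stakeholder's equilibrium ex-ante expected payoff can be written as a function of effort and critical verification level: $$U_J(\beta_J(q),\bar a(\beta_J(q),q))=\tfrac12(X-I)-\tfrac12(1-\beta_J(q))\Big(1-\tfrac{\bar a(\beta_J(q),q)}{2}\Big)I.$$ Regime C: there is no signal. The stakeholder first commits to $a$ (carried out when $r=g$); the auditor observes $a$ and best-responds with $\beta(a)=\frac l2a$. The stakeholder chooses $a$ to maximize $$\tfrac12(X-I)-\tfrac12(1-\beta(a))(1-a)I-\Big(\tfrac12(1-\beta(a))+\tfrac12\Big)\tfrac{ca^2}{2};$$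 the equilibrium is unique, with verification level $a_C$ and effort $\beta_C=\frac l2a_C$, and $U_C(\beta_C,a_C)$ is the resulting maximal value.
   Formalization: In part 2, continuity in q alone does not make the derivative exist or be nonzero; proved instead: U_J is strictly increasing in q on [0,1], and dU_J/dq exists and is >0 at each q where the partial derivative of ā in q (effort held at β_J(q)) exists and is nonzero. *)

theory Defs
  imports "HOL-Probability.Probability_Mass_Function"
begin

datatype state = Good | Bad

type_synonym 'w info = "state \<Rightarrow> 'w pmf"

text \<open>Blackwell order: the dominated experiment is a garbling of the dominating one, by a
  Markov kernel that does not depend on the state.\<close>

definition blackwell_dominates :: "'v info \<Rightarrow> 'w info \<Rightarrow> bool" where
  "blackwell_dominates \<rho> \<pi> \<longleftrightarrow> (\<exists>\<kappa> :: 'v \<Rightarrow> 'w pmf. \<forall>\<theta>. \<pi> \<theta> = bind_pmf (\<rho> \<theta>) \<kappa>)"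

definition strictly_blackwell_dominates :: "'v info \<Rightarrow> 'w info \<Rightarrow> bool" where
  "strictly_blackwell_dominates \<rho> \<pi> \<longleftrightarrow>
     blackwell_dominates \<rho> \<pi> \<and> \<not> blackwell_dominates \<pi> \<rho>"

definition uninformative :: "'w info \<Rightarrow> bool" where
  "uninformative \<pi> \<longleftrightarrow> \<pi> Good = \<pi> Bad"

definition perfectly_informative :: "'w info \<Rightarrow> bool" where
  "perfectly_informative \<pi> \<longleftrightarrow> set_pmf (\<pi> Good) \<inter> set_pmf (\<pi> Bad) = {}"

text \<open>All realizations lie in one finite type; the supports may vary with \<open>q\<close>.\<close>

definition continuous_nested_family :: "(real \<Rightarrow> 'w::finite info) \<Rightarrow> bool" where
  "continuous_nested_family \<pi> \<longleftrightarrow>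
     (\<forall>q\<in>{0..1}. \<forall>q'\<in>{0..1}. q < q' \<longrightarrow> strictly_blackwell_dominates (\<pi> q') (\<pi> q)) \<and>
     uninformative (\<pi> 0) \<and>
     perfectly_informative (\<pi> 1) \<and>
     (\<forall>\<theta> \<omega>. continuous_on {0..1} (\<lambda>q. pmf (\<pi> q \<theta>) \<omega>))"

text \<open>The probability of the bad state given a good report and signal \<open>\<omega>\<close>, when effort is \<open>\<beta>\<close>.
  By Bayes' rule: the prior is uniform, a good report has probability \<open>1\<close> in the good state and
  \<open>1 - \<beta>\<close> in the bad state, and report and signal are independent conditional on the state.\<close>

definition posterior_bad :: "'w info \<Rightarrow> real \<Rightarrow> 'w \<Rightarrow> real" where
  "posterior_bad \<pi> \<beta> \<omega> =
     (1 - \<beta>) * pmf (\<pi> Bad) \<omega> / ((1 - \<beta>) * pmf (\<pi> Bad) \<omega> + pmf (\<pi> Good) \<omega>)"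

definition verification_J :: "real \<Rightarrow> 'w info \<Rightarrow> real \<Rightarrow> 'w \<Rightarrow> real" where
  "verification_J i \<pi> \<beta> \<omega> = i * posterior_bad \<pi> \<beta> \<omega>"

definition critical_verification :: "real \<Rightarrow> 'w info \<Rightarrow> real \<Rightarrow> real" where
  "critical_verification i \<pi> \<beta> =
     (\<Sum>\<omega> \<in> set_pmf (\<pi> Good) \<union> set_pmf (\<pi> Bad). pmf (\<pi> Bad) \<omega> * verification_J i \<pi> \<beta> \<omega>)"

definition effort_J :: "real \<Rightarrow> real \<Rightarrow> 'w info \<Rightarrow> real" where
  "effort_J i l \<pi> = (THE \<beta>. 0 \<le> \<beta> \<and> \<beta> < 1 \<and> \<beta> = l / 2 * critical_verification i \<pi> \<beta>)"

definition U_J :: "real \<Rightarrow> real \<Rightarrow> real \<Rightarrow> real \<Rightarrow> real" where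
  "U_J X I \<beta> abar = 1/2 * (X - I) - 1/2 * (1 - \<beta>) * (1 - abar / 2) * I"

definition U_C :: "real \<Rightarrow> real \<Rightarrow> real \<Rightarrow> real \<Rightarrow> real \<Rightarrow> real" where
  "U_C X I c \<beta> a =
     1/2 * (X - I) - 1/2 * (1 - \<beta>) * (1 - a) * I - (1/2 * (1 - \<beta>) + 1/2) * (c * a\<^sup>2 / 2)"

definition best_response_C :: "real \<Rightarrow> real \<Rightarrow> real" where
  "best_response_C l a = l / 2 * a"

definition verification_C :: "real \<Rightarrow> real \<Rightarrow> real \<Rightarrow> real \<Rightarrow> real" where
  "verification_C X I c l = (ARG_MAX (\<lambda>a. U_C X I c (best_response_C l a) a) a. 0 \<le> a \<and> a < 1)"

definition effort_C :: "real \<Rightarrow> real \<Rightarrow> real \<Rightarrow> real \<Rightarrow> real" where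
  "effort_C X I c l = best_response_C l (verification_C X I c l)"

definition equilibrium_payoff_J :: "real \<Rightarrow> real \<Rightarrow> real \<Rightarrow> real \<Rightarrow> 'w info \<Rightarrow> real" where
  "equilibrium_payoff_J X I i l \<pi> =
     U_J X I (effort_J i l \<pi>) (critical_verification i \<pi> (effort_J i l \<pi>))"

definition equilibrium_payoff_C :: "real \<Rightarrow> real \<Rightarrow> real \<Rightarrow> real \<Rightarrow> real" where
  "equilibrium_payoff_C X I c l = U_C X I c (effort_C X I c l) (verification_C X I c l)"

text \<open>The formulas for regime J are those of the underlying game. When the auditor exerts effort
  \<open>\<beta>\<close> and the stakeholder verifies at level \<open>a \<omega>\<close> after a good report and signal \<open>\<omega>\<close>, the two
  expected payoffs are as follows; the facts below show that \<^const>\<open>verification_J\<close> is optimal for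
  the stakeholder, that effort \<open>l / 2\<close> times the critical level is optimal for the auditor,
  and that \<^const>\<open>U_J\<close> is the resulting payoff of the stakeholder.\<close>

definition stakeholder_payoff :: "real \<Rightarrow> real \<Rightarrow> real \<Rightarrow> 'w::finite info \<Rightarrow> real \<Rightarrow> ('w \<Rightarrow> real) \<Rightarrow> real" where
  "stakeholder_payoff X I c \<pi> \<beta> a =
     1/2 * (\<Sum>\<omega>\<in>UNIV. pmf (\<pi> Good) \<omega> * (X - I - 1/2 * c * (a \<omega>)\<^sup>2)) +
     1/2 * (1 - \<beta>) * (\<Sum>\<omega>\<in>UNIV. pmf (\<pi> Bad) \<omega> * ((1 - a \<omega>) * (- I) - 1/2 * c * (a \<omega>)\<^sup>2))"

definition auditor_payoff :: "real \<Rightarrow> real \<Rightarrow> 'w::finite info \<Rightarrow> ('w \<Rightarrow> real) \<Rightarrow> real \<Rightarrow> real" where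
  "auditor_payoff k L \<pi> a \<beta> =
     - (1/2 * (1 - \<beta>) * (\<Sum>\<omega>\<in>UNIV. pmf (\<pi> Bad) \<omega> * a \<omega>) * L) - 1/2 * k * \<beta>\<^sup>2"

lemma critical_verification_eq:
  fixes \<pi> :: "'w::finite info"
  shows "critical_verification i \<pi> \<beta> = (\<Sum>\<omega>\<in>UNIV. pmf (\<pi> Bad) \<omega> * verification_J i \<pi> \<beta> \<omega>)"
  unfolding critical_verification_def
  by (rule sum.mono_neutral_left) (auto simp: set_pmf_iff)

lemma verification_J_foc:
  assumes "\<beta> < 1"
  shows "((1 - \<beta>) * pmf (\<pi> Bad) \<omega> + pmf (\<pi> Good) \<omega>) * verification_J i \<pi> \<beta> \<omega> =
    i * ((1 - \<beta>) * pmf (\<pi> Bad) \<omega>)"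
proof (cases "(1 - \<beta>) * pmf (\<pi> Bad) \<omega> + pmf (\<pi> Good) \<omega> = 0")
  case True
  moreover have "(1 - \<beta>) * pmf (\<pi> Bad) \<omega> \<ge> 0" "pmf (\<pi> Good) \<omega> \<ge> 0"
    using assms by simp_all
  ultimately have "(1 - \<beta>) * pmf (\<pi> Bad) \<omega> = 0" by linarith
  then show ?thesis unfolding True by simp
next
  case False
  then show ?thesis by (simp add: verification_J_def posterior_bad_def)
qed

lemma verification_J_optimal:
  fixes \<pi> :: "'w::finite info"
  assumes "\<beta> < 1" and "0 < c"
  shows "stakeholder_payoff X I c \<pi> \<beta> a \<le> stakeholder_payoff X I c \<pi> \<beta> (verification_J (I / c) \<pi> \<beta>)"
proof -
  let ?v = "verification_J (I / c) \<pi> \<beta>"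
  let ?t = "\<lambda>(a :: 'w \<Rightarrow> real) \<omega>. pmf (\<pi> Good) \<omega> * (X - I - 1/2 * c * (a \<omega>)\<^sup>2) +
    (1 - \<beta>) * (pmf (\<pi> Bad) \<omega> * ((1 - a \<omega>) * (- I) - 1/2 * c * (a \<omega>)\<^sup>2))"
  have split: "stakeholder_payoff X I c \<pi> \<beta> b = 1/2 * (\<Sum>\<omega>\<in>UNIV. ?t b \<omega>)" for b
    unfolding stakeholder_payoff_def sum.distrib sum_distrib_left[symmetric] by (simp add: distrib_left)
  have "?t a \<omega> \<le> ?t ?v \<omega>" for \<omega>
  proof -
    define m g x v where "m = (1 - \<beta>) * pmf (\<pi> Bad) \<omega>" and "g = pmf (\<pi> Good) \<omega>"
      and "x = a \<omega>" and "v = ?v \<omega>"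
    have nn: "m + g \<ge> 0" using assms unfolding m_def g_def by simp
    have "(m + g) * v = I / c * m"
      using verification_J_foc[OF assms(1), of \<pi> \<omega> "I / c"] unfolding m_def g_def v_def by simp
    then have foc: "I * m = c * (m + g) * v" using assms(2) by (simp add: field_simps)
    have "?t ?v \<omega> - ?t a \<omega> = I * m * (v - x) - 1/2 * c * (m + g) * (v\<^sup>2 - x\<^sup>2)"
      unfolding m_def g_def x_def v_def by algebra
    also have "\<dots> = 1/2 * c * (m + g) * (v - x)\<^sup>2" unfolding foc by algebra
    also have "\<dots> \<ge> 0" using nn assms(2) by simp
    finally show ?thesis by simp
  qed
  then show ?thesis unfolding split by (simp add: sum_mono)
qed

lemma effort_J_optimal:
  fixes \<pi> :: "'w::finite info"
  assumes "0 < k" and "\<beta> = (L / k) / 2 * (\<Sum>\<omega>\<in>UNIV. pmf (\<pi> Bad) \<omega> * a \<omega>)"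
  shows "auditor_payoff k L \<pi> a \<beta>' \<le> auditor_payoff k L \<pi> a \<beta>"
proof -
  define A where "A = (\<Sum>\<omega>\<in>UNIV. pmf (\<pi> Bad) \<omega> * a \<omega>)"
  have foc: "L * A = 2 * k * \<beta>" using assms unfolding A_def by simp
  have "auditor_payoff k L \<pi> a \<beta> - auditor_payoff k L \<pi> a \<beta>' =
      1/2 * (L * A) * (\<beta> - \<beta>') - 1/2 * k * (\<beta>\<^sup>2 - \<beta>'\<^sup>2)"
    unfolding auditor_payoff_def A_def[symmetric] by algebra
  also have "\<dots> = 1/2 * k * (\<beta> - \<beta>')\<^sup>2" unfolding foc by algebra
  also have "\<dots> \<ge> 0" using assms(1) by simp
  finally show ?thesis by simp
qed

lemma stakeholder_payoff_eq_U_J: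
  fixes \<pi> :: "'w::finite info"
  assumes "\<beta> < 1" and "0 < c"
  shows "stakeholder_payoff X I c \<pi> \<beta> (verification_J (I / c) \<pi> \<beta>) =
    U_J X I \<beta> (critical_verification (I / c) \<pi> \<beta>)"
proof -
  let ?v = "verification_J (I / c) \<pi> \<beta>"
  have t: "pmf (\<pi> Good) \<omega> * (X - I - 1/2 * c * (?v \<omega>)\<^sup>2) +
      (1 - \<beta>) * (pmf (\<pi> Bad) \<omega> * ((1 - ?v \<omega>) * (- I) - 1/2 * c * (?v \<omega>)\<^sup>2)) =
      pmf (\<pi> Good) \<omega> * (X - I) - (1 - \<beta>) * I * pmf (\<pi> Bad) \<omega> +
      1/2 * (1 - \<beta>) * I * (pmf (\<pi> Bad) \<omega> * ?v \<omega>)" for \<omega>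
  proof -
    define p g v where "p = pmf (\<pi> Bad) \<omega>" and "g = pmf (\<pi> Good) \<omega>" and "v = ?v \<omega>"
    have "((1 - \<beta>) * p + g) * v = I / c * ((1 - \<beta>) * p)"
      using verification_J_foc[OF assms(1), of \<pi> \<omega> "I / c"] unfolding p_def g_def v_def .
    then have "c * ((1 - \<beta>) * p + g) * v = I * ((1 - \<beta>) * p)"
      using assms(2) by (simp add: field_simps)
    then have "c * ((1 - \<beta>) * p + g) * v * v = I * ((1 - \<beta>) * p) * v" by simp
    then show ?thesis unfolding p_def[symmetric] g_def[symmetric] v_def[symmetric]
      by (simp add: power2_eq_square field_simps)
  qed
  have "stakeholder_payoff X I c \<pi> \<beta> ?v = 1/2 * (\<Sum>\<omega>\<in>UNIV.
      pmf (\<pi> Good) \<omega> * (X - I) - (1 - \<beta>) * I * pmf (\<pi> Bad) \<omega> +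
      1/2 * (1 - \<beta>) * I * (pmf (\<pi> Bad) \<omega> * ?v \<omega>))"
    unfolding t[symmetric] stakeholder_payoff_def sum.distrib sum_distrib_left[symmetric]
    by (simp add: distrib_left)
  also have "\<dots> = 1/2 * ((X - I) * (\<Sum>\<omega>\<in>UNIV. pmf (\<pi> Good) \<omega>) -
      (1 - \<beta>) * I * (\<Sum>\<omega>\<in>UNIV. pmf (\<pi> Bad) \<omega>) +
      1/2 * (1 - \<beta>) * I * critical_verification (I / c) \<pi> \<beta>)"
    unfolding critical_verification_eq sum_distrib_left sum.distrib sum_subtractf
    by (simp add: mult.commute)
  also have "\<dots> = U_J X I \<beta> (critical_verification (I / c) \<pi> \<beta>)"
    by (simp add: sum_pmf_eq_1 U_J_def field_simps)
  finally show ?thesis .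
qed

end

theory Submission imports Defs begin

text \<open>
  Write \<open>h(\<pi>, \<beta>)\<close> for the critical verification level. It is the mean of the posterior belief in
  the bad state, conditional on that state, hence up to scaling the second moment of the posterior;
  by the law of total variance it strictly increases along the strict Blackwell order. It decreases
  in \<open>\<beta>\<close>, so the solution of \<open>\<beta> = l/2 h(\<pi>, \<beta>)\<close> moves up with informativeness, and in equilibrium
  the payoff in regime J is an increasing function of \<open>\<beta>\<close> alone.

  Without information, committing to the level of regime J gives the payoff of regime J. That level
  is statically optimal at the effort it induces, so raising it has a positive first-order effect,
  through the effort. With perfect information, the payoff difference for any level of
  regime C is a polynomial that is visibly positive once written around the level of regime J.
\<close>

section \<open>Belief in the bad state as a function of effort and signal\<close>

text \<open>Here \<open>t\<close> stands for \<open>1 - \<beta>\<close>, and \<open>p\<close>,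
  \<open>g\<close> for the probabilities of one signal in the bad and the good state; the value is
  \<open>p\<close> times the posterior. It is homogeneous of degree one in \<open>(p, g)\<close>, so
  splitting a signal at random preserves the total.\<close>

definition bad_mass :: "real \<Rightarrow> real \<Rightarrow> real \<Rightarrow> real" where
  "bad_mass t p g = t * p\<^sup>2 / (t * p + g)"

definition bad_belief :: "'w::finite info \<Rightarrow> real \<Rightarrow> real" where
  "bad_belief \<pi> t = (\<Sum>\<omega>\<in>UNIV. bad_mass t (pmf (\<pi> Bad) \<omega>) (pmf (\<pi> Good) \<omega>))"

text \<open>The difference quotient of \<open>bad_belief \<pi>\<close> between \<open>s\<close> and
  \<open>t\<close> with the factor \<open>t - s\<close> cancelled. It remains meaningful at
  \<open>s = t\<close>, where it is the derivative.\<close>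

definition bad_belief_slope :: "'w::finite info \<Rightarrow> real \<Rightarrow> real \<Rightarrow> real" where
  "bad_belief_slope \<pi> s t = (\<Sum>\<omega>\<in>UNIV. (pmf (\<pi> Bad) \<omega>)\<^sup>2 * pmf (\<pi> Good) \<omega> /
     ((t * pmf (\<pi> Bad) \<omega> + pmf (\<pi> Good) \<omega>) * (s * pmf (\<pi> Bad) \<omega> + pmf (\<pi> Good) \<omega>)))"

lemma critical_verification_eq_bad_belief:
  "critical_verification i \<pi> \<beta> = i * bad_belief \<pi> (1 - \<beta>)"
  unfolding critical_verification_eq bad_belief_def bad_mass_def verification_J_def posterior_bad_def
    sum_distrib_left
  by (rule sum.cong) (simp_all add: power2_eq_square)

lemma mult_add_eq_0_iff_nonneg:
  fixes t p g :: real
  assumes "t > 0" "p \<ge> 0" "g \<ge> 0"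
  shows "t * p + g = 0 \<longleftrightarrow> p = 0 \<and> g = 0"
proof -
  have "t * p \<ge> 0" using assms by simp
  then show ?thesis using assms by (auto simp: add_nonneg_eq_0_iff)
qed

lemma bad_mass_diff:
  assumes "t > 0" "s > 0" "p \<ge> 0" "g \<ge> 0"
  shows "bad_mass t p g - bad_mass s p g = (t - s) * (p\<^sup>2 * g / ((t * p + g) * (s * p + g)))"
proof (cases "p = 0 \<and> g = 0")
  case True
  then show ?thesis by (simp add: bad_mass_def)
next
  case False
  then have "t * p + g \<noteq> 0" "s * p + g \<noteq> 0"
    using assms by (simp_all add: mult_add_eq_0_iff_nonneg)
  then show ?thesis unfolding bad_mass_def
    by (simp add: divide_simps) algebra
qed

lemma bad_belief_diff:
  assumes "t > 0" "s > 0"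
  shows "bad_belief \<pi> t - bad_belief \<pi> s = (t - s) * bad_belief_slope \<pi> s t"
  unfolding bad_belief_def bad_belief_slope_def sum_subtractf[symmetric] sum_distrib_left
  by (rule sum.cong) (use assms in \<open>simp_all add: bad_mass_diff\<close>)

lemma bad_belief_slope_nonneg: "t > 0 \<Longrightarrow> s > 0 \<Longrightarrow> bad_belief_slope \<pi> s t \<ge> 0"
  unfolding bad_belief_slope_def by (intro sum_nonneg) simp

lemma bad_belief_nonneg: "t > 0 \<Longrightarrow> bad_belief \<pi> t \<ge> 0"
  unfolding bad_belief_def bad_mass_def by (intro sum_nonneg) simp

lemma bad_belief_le_1:
  assumes "t > 0"
  shows "bad_belief \<pi> t \<le> 1"
proof -
  have "bad_mass t p g \<le> p" if "p \<ge> 0" "g \<ge> 0" for p g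
  proof (cases "p = 0 \<and> g = 0")
    case True
    then show ?thesis by (simp add: bad_mass_def)
  next
    case False
    have "t * p + g \<ge> 0" using assms that by simp
    moreover have "t * p + g \<noteq> 0" using False assms that by (simp add: mult_add_eq_0_iff_nonneg)
    ultimately have "t * p + g > 0" by simp
    moreover have "p * g \<ge> 0" using that by simp
    ultimately show ?thesis unfolding bad_mass_def
      by (simp add: divide_simps power2_eq_square algebra_simps)
  qed
  then have "bad_belief \<pi> t \<le> (\<Sum>\<omega>\<in>UNIV. pmf (\<pi> Bad) \<omega>)"
    unfolding bad_belief_def by (intro sum_mono) simp
  then show ?thesis by (simp add: sum_pmf_eq_1)
qed

lemma continuous_on_bad_belief: "continuous_on {0<..} (bad_belief \<pi>)"
proof -
  have "continuous_on {0<..} (\<lambda>t. bad_mass t p g)" if "p \<ge> 0" "g \<ge> 0" for p g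
  proof (cases "p = 0 \<and> g = 0")
    case True
    then show ?thesis by (simp add: bad_mass_def)
  next
    case False
    then have "t * p + g \<noteq> 0" if "t > 0" for t
      using \<open>p \<ge> 0\<close> \<open>g \<ge> 0\<close> that by (simp add: mult_add_eq_0_iff_nonneg)
    then show ?thesis unfolding bad_mass_def by (intro continuous_intros) auto
  qed
  then show ?thesis unfolding bad_belief_def[abs_def] by (intro continuous_on_sum) simp
qed

lemma bad_belief_uninformative:
  assumes "uninformative \<pi>" "t > 0"
  shows "bad_belief \<pi> t = t / (1 + t)"
proof -
  have "bad_mass t p p = p * (t / (1 + t))" for p
  proof -
    have "t * p + p = (1 + t) * p" by (simp add: algebra_simps)
    then show ?thesis unfolding bad_mass_def by (cases "p = 0") (simp_all add: power2_eq_square)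
  qed
  then have "bad_belief \<pi> t = (\<Sum>\<omega>\<in>UNIV. pmf (\<pi> Bad) \<omega>) * (t / (1 + t))"
    using assms(1) unfolding bad_belief_def uninformative_def sum_distrib_right by simp
  then show ?thesis by (simp add: sum_pmf_eq_1)
qed

lemma bad_belief_perfectly_informative:
  assumes "perfectly_informative \<pi>" "t > 0"
  shows "bad_belief \<pi> t = 1"
proof -
  have "bad_mass t (pmf (\<pi> Bad) \<omega>) (pmf (\<pi> Good) \<omega>) = pmf (\<pi> Bad) \<omega>" for \<omega>
  proof -
    have "pmf (\<pi> Bad) \<omega> = 0 \<or> pmf (\<pi> Good) \<omega> = 0"
      using assms(1) by (auto simp: perfectly_informative_def set_pmf_iff)
    then show ?thesis using assms(2) by (auto simp: bad_mass_def power2_eq_square)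
  qed
  then show ?thesis by (simp add: bad_belief_def sum_pmf_eq_1)
qed

subsection \<open>Blackwell order\<close>

text \<open>Law of total variance: pooling signals lowers the second moment of the belief by its
  variance within the pool.\<close>

lemma bad_mass_pool:
  fixes x y :: "'v \<Rightarrow> real" and t :: real
  assumes fin: "finite A" and t: "t > 0" and nn: "\<And>v. v \<in> A \<Longrightarrow> x v \<ge> 0" "\<And>v. v \<in> A \<Longrightarrow> y v \<ge> 0"
  defines "m \<equiv> t * sum x A / (t * sum x A + sum y A)"
  shows "t * ((\<Sum>v\<in>A. bad_mass t (x v) (y v)) - bad_mass t (sum x A) (sum y A)) =
    (\<Sum>v\<in>A. (t * x v - m * (t * x v + y v))\<^sup>2 / (t * x v + y v))"
proof -
  define D where "D = t * sum x A + sum y A"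
  have D: "D = (\<Sum>v\<in>A. t * x v + y v)"
    by (simp add: D_def sum.distrib sum_distrib_left)
  \<comment> \<open>Expand the square into second moment, cross term and squared mean;
    \<open>m\<close> is the belief after pooling all of \<open>A\<close>.\<close>
  have summand: "(t * x v - m * (t * x v + y v))\<^sup>2 / (t * x v + y v) =
      t * bad_mass t (x v) (y v) - 2 * m * (t * x v) + m\<^sup>2 * (t * x v + y v)" if "v \<in> A" for v
  proof (cases "x v = 0 \<and> y v = 0")
    case True
    then show ?thesis by (simp add: bad_mass_def)
  next
    case False
    then have "t * x v + y v \<noteq> 0" using nn that t by (simp add: mult_add_eq_0_iff_nonneg)
    then show ?thesis unfolding bad_mass_def
      by (simp add: divide_simps) algebra
  qed
  have "(\<Sum>v\<in>A. (t * x v - m * (t * x v + y v))\<^sup>2 / (t * x v + y v)) =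
      (\<Sum>v\<in>A. t * bad_mass t (x v) (y v) - 2 * m * (t * x v) + m\<^sup>2 * (t * x v + y v))"
    by (rule sum.cong) (simp_all add: summand)
  also have "\<dots> = t * (\<Sum>v\<in>A. bad_mass t (x v) (y v)) - 2 * m * (t * sum x A) + m\<^sup>2 * D"
    by (simp add: D sum.distrib sum_subtractf flip: sum_distrib_left)
  \<comment> \<open>Since \<open>m * D = t * sum x A\<close>, the last two terms combine to
    \<open>- m\<^sup>2 * D\<close>, which is minus \<open>t\<close> times the pooled
    \<open>bad_mass\<close>.\<close>
  also have "\<dots> = t * ((\<Sum>v\<in>A. bad_mass t (x v) (y v)) - bad_mass t (sum x A) (sum y A))"
  proof (cases "D = 0")
    case True
    have "sum x A = 0"
      using True nn t by (simp add: D_def mult_add_eq_0_iff_nonneg sum_nonneg)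
    then show ?thesis using True by (simp add: bad_mass_def)
  next
    case False
    then show ?thesis unfolding m_def bad_mass_def D_def[symmetric]
      by (simp add: divide_simps power2_eq_square algebra_simps)
  qed
  finally show ?thesis by simp
qed

lemma pmf_bind_finite:
  fixes p :: "'v::finite pmf"
  shows "pmf (bind_pmf p \<kappa>) \<omega> = (\<Sum>v\<in>UNIV. pmf p v * pmf (\<kappa> v) \<omega>)"
  by (simp add: pmf_bind integral_measure_pmf_real[where A=UNIV] mult.commute)

lemma ex_pmf_finite:
  fixes f :: "'v::finite \<Rightarrow> real"
  assumes "\<And>x. f x \<ge> 0" "sum f UNIV = 1"
  shows "\<exists>p. \<forall>x. pmf p x = f x"
proof -
  have "(\<integral>\<^sup>+ x. ennreal (f x) \<partial>count_space UNIV) = 1"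
    using assms by (simp add: nn_integral_count_space_finite)
  then show ?thesis using assms(1) by (intro exI[of _ "embed_pmf f"]) (simp add: pmf_embed_pmf)
qed

text \<open>If no signal of \<open>\<pi>\<close> pools signals of \<open>\<rho>\<close> with different beliefs, then the distribution of
  the \<open>\<rho>\<close>-signal given the \<open>\<pi>\<close>-signal does not depend on the state, and is a garbling back.\<close>

lemma blackwell_dominates_reverse:
  fixes \<rho> :: "'v::finite info" and \<pi> :: "'w::finite info"
  assumes t: "t > 0" and \<pi>: "\<And>\<theta>. \<pi> \<theta> = bind_pmf (\<rho> \<theta>) \<kappa>"
    and eq: "\<And>v \<omega>. t * (pmf (\<rho> Bad) v * pmf (\<kappa> v) \<omega>) =
      t * pmf (\<pi> Bad) \<omega> / (t * pmf (\<pi> Bad) \<omega> + pmf (\<pi> Good) \<omega>) *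
      (t * (pmf (\<rho> Bad) v * pmf (\<kappa> v) \<omega>) + pmf (\<rho> Good) v * pmf (\<kappa> v) \<omega>)"
  shows "blackwell_dominates \<pi> \<rho>"
proof -
  \<comment> \<open>\<open>D\<close> and \<open>Q\<close> weigh the signal \<open>\<omega>\<close>
    and the pair \<open>(v, \<omega>)\<close> under the unnormalised mixture with weight
    \<open>t\<close> on the bad state and \<open>1\<close> on the good state.\<close>
  define D where "D \<omega> = t * pmf (\<pi> Bad) \<omega> + pmf (\<pi> Good) \<omega>" for \<omega>
  define Q where "Q v \<omega> = t * (pmf (\<rho> Bad) v * pmf (\<kappa> v) \<omega>) + pmf (\<rho> Good) v * pmf (\<kappa> v) \<omega>" for v \<omega>
  have Q_nonneg: "Q v \<omega> \<ge> 0" for v \<omega> using t by (simp add: Q_def)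
  have sum_Q: "(\<Sum>v\<in>UNIV. Q v \<omega>) = D \<omega>" for \<omega>
    by (simp add: Q_def D_def \<pi> pmf_bind_finite sum.distrib sum_distrib_left)
  have D_nonneg: "D \<omega> \<ge> 0" for \<omega> using t by (simp add: D_def)
  \<comment> \<open>The garbling back is the conditional distribution of \<open>v\<close> given
    \<open>\<omega>\<close> under this mixture. It is arbitrary where \<open>D \<omega> = 0\<close>,
    as such \<open>\<omega>\<close> never occurs.\<close>
  have "\<exists>p. \<forall>v. D \<omega> \<noteq> 0 \<longrightarrow> pmf p v = Q v \<omega> / D \<omega>" for \<omega>
  proof (cases "D \<omega> = 0")
    case False
    have "\<exists>p. \<forall>v. pmf p v = Q v \<omega> / D \<omega>"
      using False D_nonneg Q_nonneg
      by (intro ex_pmf_finite) (simp_all add: sum_divide_distrib[symmetric] sum_Q)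
    then show ?thesis by blast
  qed simp
  then obtain \<mu> where \<mu>: "\<And>\<omega> v. D \<omega> \<noteq> 0 \<Longrightarrow> pmf (\<mu> \<omega>) v = Q v \<omega> / D \<omega>" by metis
  have key: "pmf (\<pi> \<theta>) \<omega> * pmf (\<mu> \<omega>) v = pmf (\<rho> \<theta>) v * pmf (\<kappa> v) \<omega>" for \<theta> \<omega> v
  proof (cases "D \<omega> = 0")
    case True
    then have "pmf (\<pi> Bad) \<omega> = 0 \<and> pmf (\<pi> Good) \<omega> = 0"
      using t by (simp add: D_def mult_add_eq_0_iff_nonneg)
    then have "pmf (\<pi> \<theta>) \<omega> = 0" by (cases \<theta>) auto
    moreover from this have "(\<Sum>v\<in>UNIV. pmf (\<rho> \<theta>) v * pmf (\<kappa> v) \<omega>) = 0"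
      by (simp add: \<pi> pmf_bind_finite)
    then have "pmf (\<rho> \<theta>) v * pmf (\<kappa> v) \<omega> = 0"
      by (subst (asm) sum_nonneg_eq_0_iff) auto
    ultimately show ?thesis by simp
  next
    case False
    have "t * (pmf (\<rho> Bad) v * pmf (\<kappa> v) \<omega>) = t * (pmf (\<pi> Bad) \<omega> * pmf (\<mu> \<omega>) v)"
      using eq[of v \<omega>] unfolding D_def[symmetric] Q_def[symmetric] \<mu>[OF False] by simp
    then have bad: "pmf (\<rho> Bad) v * pmf (\<kappa> v) \<omega> = pmf (\<pi> Bad) \<omega> * pmf (\<mu> \<omega>) v"
      using t by simp
    \<comment> \<open>The good state carries what remains of the joint weight once the part of the
      bad state is removed.\<close>
    have "pmf (\<mu> \<omega>) v * D \<omega> = Q v \<omega>" using \<mu>[OF False] False by simp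
    then have "pmf (\<rho> Good) v * pmf (\<kappa> v) \<omega> = pmf (\<pi> Good) \<omega> * pmf (\<mu> \<omega>) v"
      unfolding D_def Q_def bad by (simp add: algebra_simps)
    with bad show ?thesis by (cases \<theta>) auto
  qed
  have "\<rho> \<theta> = bind_pmf (\<pi> \<theta>) \<mu>" for \<theta>
  proof (rule pmf_eqI)
    fix v
    show "pmf (\<rho> \<theta>) v = pmf (bind_pmf (\<pi> \<theta>) \<mu>) v"
      by (simp add: pmf_bind_finite key sum_distrib_left[symmetric] sum_pmf_eq_1)
  qed
  then show ?thesis unfolding blackwell_dominates_def by blast
qed

text \<open>Up to the factor \<open>t\<close>, the gap is the sum over signals of
  \<open>\<pi>\<close> of the variance of the \<open>\<rho>\<close>-belief within each pool. If it
  vanished, no pool would mix different beliefs and \<open>\<pi>\<close> would dominate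
  \<open>\<rho>\<close> in turn.\<close>

lemma bad_belief_strict_mono_blackwell:
  fixes \<rho> :: "'v::finite info" and \<pi> :: "'w::finite info"
  assumes dom: "strictly_blackwell_dominates \<rho> \<pi>" and t: "t > 0"
  shows "bad_belief \<pi> t < bad_belief \<rho> t"
proof -
  obtain \<kappa> where \<pi>: "\<And>\<theta>. \<pi> \<theta> = bind_pmf (\<rho> \<theta>) \<kappa>"
    using dom unfolding strictly_blackwell_dominates_def blackwell_dominates_def by blast
  \<comment> \<open>\<open>x\<close> and \<open>y\<close> are the joint probabilities of
    \<open>v\<close> and its garbled signal \<open>\<omega>\<close> in the two states,
    \<open>m\<close> is the belief after \<open>\<omega>\<close>, and \<open>e\<close> is the
    contribution of \<open>v\<close> to the variance within the pool.\<close>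
  define x where "x \<omega> v = pmf (\<rho> Bad) v * pmf (\<kappa> v) \<omega>" for v \<omega>
  define y where "y \<omega> v = pmf (\<rho> Good) v * pmf (\<kappa> v) \<omega>" for v \<omega>
  define m where "m \<omega> = t * pmf (\<pi> Bad) \<omega> / (t * pmf (\<pi> Bad) \<omega> + pmf (\<pi> Good) \<omega>)" for \<omega>
  define e where "e \<omega> v = (t * x \<omega> v - m \<omega> * (t * x \<omega> v + y \<omega> v))\<^sup>2 / (t * x \<omega> v + y \<omega> v)" for \<omega> v
  have nn: "x \<omega> v \<ge> 0" "y \<omega> v \<ge> 0" for \<omega> v by (simp_all add: x_def y_def)
  have e_nonneg: "e \<omega> v \<ge> 0" for \<omega> v using nn t by (simp add: e_def)
  have sums: "sum (x \<omega>) UNIV = pmf (\<pi> Bad) \<omega>" "sum (y \<omega>) UNIV = pmf (\<pi> Good) \<omega>" for \<omega>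
    by (simp_all add: x_def y_def \<pi> pmf_bind_finite)
  have pool: "t * ((\<Sum>v\<in>UNIV. bad_mass t (x \<omega> v) (y \<omega> v)) -
      bad_mass t (pmf (\<pi> Bad) \<omega>) (pmf (\<pi> Good) \<omega>)) = (\<Sum>v\<in>UNIV. e \<omega> v)" for \<omega>
    using bad_mass_pool[of UNIV t "x \<omega>" "y \<omega>"] nn t unfolding sums e_def m_def by simp
  \<comment> \<open>By homogeneity, \<open>bad_belief \<rho> t\<close> can be computed from the
    pairs \<open>(v, \<omega>)\<close>, which can then be regrouped by
    \<open>\<omega>\<close>.\<close>
  have hom: "bad_mass t (p * r) (g * r) = bad_mass t p g * r" for p g r
  proof (cases "r = 0")
    case False
    have "t * (p * r) + g * r = (t * p + g) * r" by (simp add: algebra_simps)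
    then show ?thesis using False by (simp add: bad_mass_def power2_eq_square)
  qed (simp add: bad_mass_def)
  have "bad_belief \<rho> t = (\<Sum>v\<in>UNIV. bad_mass t (pmf (\<rho> Bad) v) (pmf (\<rho> Good) v) * (\<Sum>\<omega>\<in>UNIV. pmf (\<kappa> v) \<omega>))"
    by (simp add: bad_belief_def sum_pmf_eq_1)
  also have "\<dots> = (\<Sum>v\<in>UNIV. \<Sum>\<omega>\<in>UNIV. bad_mass t (x \<omega> v) (y \<omega> v))"
    by (simp add: x_def y_def hom sum_distrib_left)
  also have "\<dots> = (\<Sum>\<omega>\<in>UNIV. \<Sum>v\<in>UNIV. bad_mass t (x \<omega> v) (y \<omega> v))" by (rule sum.swap)
  finally have diff: "t * (bad_belief \<rho> t - bad_belief \<pi> t) = (\<Sum>\<omega>\<in>UNIV. \<Sum>v\<in>UNIV. e \<omega> v)"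
    unfolding bad_belief_def[of \<pi>] pool[symmetric] by (simp add: sum_subtractf sum_distrib_left[symmetric])
  have "(\<Sum>\<omega>\<in>UNIV. \<Sum>v\<in>UNIV. e \<omega> v) \<noteq> 0"
  proof
    assume "(\<Sum>\<omega>\<in>UNIV. \<Sum>v\<in>UNIV. e \<omega> v) = 0"
    then have e0: "e \<omega> v = 0" for \<omega> v
      by (simp add: sum_nonneg_eq_0_iff sum_nonneg e_nonneg)
    have "t * x \<omega> v = m \<omega> * (t * x \<omega> v + y \<omega> v)" for \<omega> v
    proof (cases "t * x \<omega> v + y \<omega> v = 0")
      case True
      then show ?thesis using nn t by (simp add: mult_add_eq_0_iff_nonneg)
    next
      case False
      then show ?thesis using e0[of \<omega> v] by (simp add: e_def)
    qed
    then have "blackwell_dominates \<pi> \<rho>"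
      using t \<pi> unfolding x_def y_def m_def by (intro blackwell_dominates_reverse)
    then show False using dom by (simp add: strictly_blackwell_dominates_def)
  qed
  moreover have "(\<Sum>\<omega>\<in>UNIV. \<Sum>v\<in>UNIV. e \<omega> v) \<ge> 0" by (intro sum_nonneg e_nonneg)
  ultimately have "t * (bad_belief \<rho> t - bad_belief \<pi> t) > 0" using diff by simp
  then show ?thesis using t by (simp add: zero_less_mult_iff)
qed

subsection \<open>Equilibrium effort\<close>

text \<open>The right-hand side lies between 0 and 1/2 on \<open>[0, 1/2]\<close>, so the
  intermediate value theorem applies there, away from the critical point \<open>\<beta> = 1\<close>.
  It is nonincreasing in \<open>\<beta>\<close>, so two solutions coincide.\<close>

lemma effort_J_ex1:
  fixes \<pi> :: "'w::finite info"
  assumes i: "0 \<le> i" "i < 1" and l: "0 < l" "l < 1"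
  shows "\<exists>!\<beta>. 0 \<le> \<beta> \<and> \<beta> < 1 \<and> \<beta> = l / 2 * critical_verification i \<pi> \<beta>"
proof -
  define f where "f \<beta> = l / 2 * (i * bad_belief \<pi> (1 - \<beta>)) - \<beta>" for \<beta>
  have "i * bad_belief \<pi> (1/2) \<le> 1 * 1"
    using i bad_belief_le_1[of "1/2" \<pi>] bad_belief_nonneg[of "1/2" \<pi>] by (intro mult_mono) auto
  then have "l * (i * bad_belief \<pi> (1/2)) \<le> 1 * 1"
    using l i bad_belief_nonneg[of "1/2" \<pi>] by (intro mult_mono) auto
  then have "f (1/2) \<le> 0" unfolding f_def by simp
  moreover have "0 \<le> f 0" using i l bad_belief_nonneg[of 1 \<pi>] by (simp add: f_def)
  moreover have "continuous_on {0..1/2} f"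
    unfolding f_def
    by (intro continuous_intros continuous_on_compose2[OF continuous_on_bad_belief]) auto
  ultimately obtain b where b: "0 \<le> b" "b \<le> 1/2" "f b = 0"
    using IVT2'[of f "1/2" 0 0] by auto
  show ?thesis
  proof (rule ex1I[of _ b])
    show "0 \<le> b \<and> b < 1 \<and> b = l / 2 * critical_verification i \<pi> b"
      using b by (simp add: f_def critical_verification_eq_bad_belief)
    fix b' assume b': "0 \<le> b' \<and> b' < 1 \<and> b' = l / 2 * critical_verification i \<pi> b'"
    \<comment> \<open>The difference of two solutions equals itself times a nonpositive factor,
      hence is zero.\<close>
    have "b' - b = l / 2 * i * (bad_belief \<pi> (1 - b') - bad_belief \<pi> (1 - b))"
      using b b' by (simp add: f_def critical_verification_eq_bad_belief algebra_simps)
    also have "\<dots> = - (l / 2 * i * bad_belief_slope \<pi> (1 - b) (1 - b')) * (b' - b)"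
      using b b' by (subst bad_belief_diff) (simp_all add: field_simps)
    finally have "(b' - b) * (1 + l / 2 * i * bad_belief_slope \<pi> (1 - b) (1 - b')) = 0"
      by (simp add: algebra_simps)
    moreover have "l / 2 * i * bad_belief_slope \<pi> (1 - b) (1 - b') \<ge> 0"
      using b b' i l by (simp add: bad_belief_slope_nonneg)
    ultimately show "b' = b" by auto
  qed
qed

lemma effort_J_equation:
  fixes \<pi> :: "'w::finite info"
  assumes "0 \<le> i" "i < 1" "0 < l" "l < 1"
  shows "0 \<le> effort_J i l \<pi>" "effort_J i l \<pi> < 1"
    "l / 2 * critical_verification i \<pi> (effort_J i l \<pi>) = effort_J i l \<pi>"
  using theI'[OF effort_J_ex1[OF assms, of \<pi>]] unfolding effort_J_def by auto

text \<open>Beliefs are at most 1. With \<open>i < 1\<close> this keeps effort below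
  \<open>l\<close>, the range in which the payoff is shown to increase with effort.\<close>

lemma effort_J_le:
  fixes \<pi> :: "'w::finite info"
  assumes "0 \<le> i" "i < 1" "0 < l" "l < 1"
  shows "effort_J i l \<pi> \<le> l * i / 2"
proof -
  note e = effort_J_equation[OF assms, of \<pi>]
  have "bad_belief \<pi> (1 - effort_J i l \<pi>) \<le> 1" using e by (simp add: bad_belief_le_1)
  then have "l / 2 * (i * bad_belief \<pi> (1 - effort_J i l \<pi>)) \<le> l / 2 * (i * 1)"
    using assms by (intro mult_left_mono) auto
  then show ?thesis using e(3) by (simp add: critical_verification_eq_bad_belief)
qed

text \<open>An exact form of implicit differentiation: it gives monotonicity, continuity and the
  derivative of the effort at once.\<close>

lemma effort_J_diff:
  fixes \<pi> \<rho> :: "'w::finite info"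
  assumes "0 \<le> i" "i < 1" "0 < l" "l < 1"
  defines "\<beta> \<equiv> effort_J i l \<pi>"
  shows "(effort_J i l \<rho> - \<beta>) * (1 + l / 2 * i * bad_belief_slope \<rho> (1 - \<beta>) (1 - effort_J i l \<rho>)) =
    l / 2 * (critical_verification i \<rho> \<beta> - critical_verification i \<pi> \<beta>)"
proof -
  define \<beta>' where "\<beta>' = effort_J i l \<rho>"
  note e = effort_J_equation[OF assms(1-4), of \<pi>, folded \<beta>_def]
    and e' = effort_J_equation[OF assms(1-4), of \<rho>, folded \<beta>'_def]
  \<comment> \<open>The change of the critical level splits into the effect of the experiment at
    fixed effort \<open>\<beta>\<close> and the effect of effort under fixed \<open>\<rho>\<close>;
    the latter becomes a slope.\<close>
  have "bad_belief \<rho> (1 - \<beta>') - bad_belief \<rho> (1 - \<beta>) =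
      ((1 - \<beta>') - (1 - \<beta>)) * bad_belief_slope \<rho> (1 - \<beta>) (1 - \<beta>')"
    using e e' by (intro bad_belief_diff) auto
  then have "bad_belief \<rho> (1 - \<beta>') = bad_belief \<rho> (1 - \<beta>) + (\<beta> - \<beta>') * bad_belief_slope \<rho> (1 - \<beta>) (1 - \<beta>')"
    by (simp add: algebra_simps)
  then show ?thesis
    using e(3) e'(3) unfolding \<beta>'_def[symmetric] critical_verification_eq_bad_belief
    by algebra
qed

text \<open>The factor \<open>1 + ...\<close> in \<open>effort_J_diff\<close> is positive, so effort
  moves in the direction of the critical level at fixed effort.\<close>

lemma effort_J_strict_mono_blackwell:
  fixes \<pi> \<rho> :: "'w::finite info"
  assumes i: "0 < i" "i < 1" and l: "0 < l" "l < 1" and dom: "strictly_blackwell_dominates \<rho> \<pi>"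
  shows "effort_J i l \<pi> < effort_J i l \<rho>"
proof -
  define \<beta> \<beta>' where "\<beta> = effort_J i l \<pi>" and "\<beta>' = effort_J i l \<rho>"
  have b: "\<beta> < 1" "\<beta>' < 1" using effort_J_equation[of i l] i l by (auto simp: \<beta>_def \<beta>'_def)
  have "critical_verification i \<pi> \<beta> < critical_verification i \<rho> \<beta>"
    using bad_belief_strict_mono_blackwell[OF dom, of "1 - \<beta>"] b i
    by (simp add: critical_verification_eq_bad_belief)
  then have "l / 2 * (critical_verification i \<rho> \<beta> - critical_verification i \<pi> \<beta>) > 0"
    using l by simp
  then have "(\<beta>' - \<beta>) * (1 + l / 2 * i * bad_belief_slope \<rho> (1 - \<beta>) (1 - \<beta>')) > 0"
    using effort_J_diff[of i l \<rho> \<pi>] i l unfolding \<beta>_def \<beta>'_def by linarith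
  moreover have "l / 2 * i * bad_belief_slope \<rho> (1 - \<beta>) (1 - \<beta>') \<ge> 0"
    using b i l by (simp add: bad_belief_slope_nonneg)
  ultimately have "\<beta>' - \<beta> > 0" by (simp add: zero_less_mult_iff)
  then show ?thesis by (simp add: \<beta>_def \<beta>'_def)
qed

text \<open>Signals whose probability vanishes in the limit need a bound, since their summand becomes
  \<open>0 / 0\<close>.\<close>

lemma tendsto_bad_belief_slope:
  fixes \<pi> :: "'a \<Rightarrow> 'w::finite info"
  assumes lim: "\<And>\<theta> \<omega>. ((\<lambda>z. pmf (\<pi> z \<theta>) \<omega>) \<longlongrightarrow> pmf (\<pi>\<^sub>0 \<theta>) \<omega>) F"
    and \<tau>: "(\<tau> \<longlongrightarrow> t) F" and t: "t > 0"
  shows "((\<lambda>z. bad_belief_slope (\<pi> z) t (\<tau> z)) \<longlongrightarrow> bad_belief_slope \<pi>\<^sub>0 t t) F"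
  unfolding bad_belief_slope_def
proof (rule tendsto_sum)
  fix \<omega>
  let ?p = "\<lambda>z. pmf (\<pi> z Bad) \<omega>" and ?g = "\<lambda>z. pmf (\<pi> z Good) \<omega>"
  let ?P = "pmf (\<pi>\<^sub>0 Bad) \<omega>" and ?G = "pmf (\<pi>\<^sub>0 Good) \<omega>"
  show "((\<lambda>z. (?p z)\<^sup>2 * ?g z / ((\<tau> z * ?p z + ?g z) * (t * ?p z + ?g z))) \<longlongrightarrow>
      ?P\<^sup>2 * ?G / ((t * ?P + ?G) * (t * ?P + ?G))) F"
  proof (cases "?P = 0 \<and> ?G = 0")
    case False
    then have "t * ?P + ?G \<noteq> 0" using t by (simp add: mult_add_eq_0_iff_nonneg)
    then show ?thesis by (intro tendsto_intros lim \<tau>) auto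
  next
    case True
    \<comment> \<open>Dropping \<open>g\<close> from both factors of the denominator cancels
      \<open>p\<^sup>2\<close> and leaves a multiple of \<open>g\<close>, which tends to 0.\<close>
    have bound: "p\<^sup>2 * g / ((s * p + g) * (t * p + g)) \<le> 2 / (t * t) * g"
      if "p \<ge> 0" "g \<ge> 0" "s > t / 2" for p g s
    proof (cases "p = 0")
      case False
      then have p: "p > 0" using that by simp
      have "t / 2 * p * (t * p) \<le> (s * p + g) * (t * p + g)"
        using that t p by (intro mult_mono) (auto intro: add_increasing2)
      moreover have "t / 2 * p * (t * p) > 0" using t p by simp
      ultimately have "p\<^sup>2 * g / ((s * p + g) * (t * p + g)) \<le> p\<^sup>2 * g / (t / 2 * p * (t * p))"
        using that by (intro divide_left_mono) (auto intro: mult_pos_pos)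
      also have "\<dots> = 2 / (t * t) * g" using p t by (simp add: power2_eq_square)
      finally show ?thesis .
    qed (use that in simp)
    have ev: "\<forall>\<^sub>F z in F. \<tau> z > t / 2" using \<tau> t by (intro order_tendstoD) auto
    have "((\<lambda>z. 2 / (t * t) * ?g z) \<longlongrightarrow> 2 / (t * t) * ?G) F" by (intro tendsto_intros lim)
    then have "((\<lambda>z. 2 / (t * t) * ?g z) \<longlongrightarrow> 0) F" using True by simp
    then have "((\<lambda>z. (?p z)\<^sup>2 * ?g z / ((\<tau> z * ?p z + ?g z) * (t * ?p z + ?g z))) \<longlongrightarrow> 0) F"
    proof (rule tendsto_sandwich[OF _ _ tendsto_const, rotated 2])
      show "\<forall>\<^sub>F z in F. 0 \<le> (?p z)\<^sup>2 * ?g z / ((\<tau> z * ?p z + ?g z) * (t * ?p z + ?g z))"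
        using ev t by (auto elim!: eventually_mono)
      show "\<forall>\<^sub>F z in F. (?p z)\<^sup>2 * ?g z / ((\<tau> z * ?p z + ?g z) * (t * ?p z + ?g z)) \<le> 2 / (t * t) * ?g z"
        using ev bound by (auto elim!: eventually_mono)
    qed
    then show ?thesis using True by simp
  qed
qed

text \<open>Divide the identity \<open>effort_J_diff\<close> by \<open>q' - q\<close> and pass to
  the limit. Differentiability is assumed only for the critical level at frozen effort; that of
  effort is a conclusion, with \<open>s\<close> the limit of the slope term.\<close>

lemma has_real_derivative_effort_J:
  fixes \<pi> :: "real \<Rightarrow> 'w::finite info"
  assumes i: "0 < i" "i < 1" and l: "0 < l" "l < 1" and q: "q \<in> S"
    and cont: "\<And>\<theta> \<omega>. continuous_on S (\<lambda>q. pmf (\<pi> q \<theta>) \<omega>)"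
    and deriv: "((\<lambda>q'. critical_verification i (\<pi> q') (effort_J i l (\<pi> q))) has_real_derivative D) (at q within S)"
  shows "\<exists>s\<ge>0. ((\<lambda>q'. effort_J i l (\<pi> q')) has_real_derivative l / 2 * D / (1 + s)) (at q within S)"
proof -
  define b where "b q' = effort_J i l (\<pi> q')" for q'
  define h where "h q' = critical_verification i (\<pi> q') (b q)" for q'
  define r where "r q' = l / 2 * i * bad_belief_slope (\<pi> q') (1 - b q) (1 - b q')" for q'
  have b1: "b q' < 1" for q' using effort_J_equation[of i l] i l by (simp add: b_def)
  have r: "r q' \<ge> 0" for q' using b1 i l by (simp add: r_def bad_belief_slope_nonneg)
  have diff: "(b q' - b q) * (1 + r q') = l / 2 * (h q' - h q)" for q'
    using effort_J_diff[of i l "\<pi> q'" "\<pi> q"] i l unfolding b_def h_def r_def by simp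
  have h: "(h has_real_derivative D) (at q within S)"
    using deriv unfolding h_def b_def .
  have "(h \<longlongrightarrow> h q) (at q within S)"
    using DERIV_continuous[OF h] by (simp add: continuous_within)
  then have "((\<lambda>q'. l / 2 * \<bar>h q' - h q\<bar>) \<longlongrightarrow> l / 2 * \<bar>h q - h q\<bar>) (at q within S)"
    by (intro tendsto_intros)
  then have h0: "((\<lambda>q'. l / 2 * \<bar>h q' - h q\<bar>) \<longlongrightarrow> 0) (at q within S)" by simp
  \<comment> \<open>As \<open>r q' \<ge> 0\<close>, the identity bounds the change of effort by that
    of \<open>h\<close>. Effort is therefore continuous at \<open>q\<close>, which the limit of
    \<open>r\<close> requires.\<close>
  have "\<bar>b q' - b q\<bar> \<le> l / 2 * \<bar>h q' - h q\<bar>" for q'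
  proof -
    have "\<bar>b q' - b q\<bar> * 1 \<le> \<bar>b q' - b q\<bar> * (1 + r q')"
      using r[of q'] by (intro mult_left_mono) auto
    also have "\<dots> = \<bar>(b q' - b q) * (1 + r q')\<bar>" using r[of q'] by (simp add: abs_mult)
    also have "\<dots> = l / 2 * \<bar>h q' - h q\<bar>" unfolding diff using l by (simp add: abs_mult)
    finally show ?thesis by simp
  qed
  then have "((\<lambda>q'. b q' - b q) \<longlongrightarrow> 0) (at q within S)"
    by (intro Lim_null_comparison[OF _ h0] always_eventually) simp
  then have "(b \<longlongrightarrow> b q) (at q within S)" by (simp add: LIM_zero_iff)
  then have "(r \<longlongrightarrow> l / 2 * i * bad_belief_slope (\<pi> q) (1 - b q) (1 - b q)) (at q within S)"
    unfolding r_def using cont q b1[of q]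
    by (intro tendsto_intros tendsto_bad_belief_slope) (auto simp: continuous_on_def)
  then have rlim: "(r \<longlongrightarrow> r q) (at q within S)" by (simp add: r_def)
  have "((\<lambda>q'. l / 2 * ((h q' - h q) / (q' - q)) / (1 + r q')) \<longlongrightarrow> l / 2 * D / (1 + r q)) (at q within S)"
    using h r[of q] by (intro tendsto_intros rlim) (auto simp: has_field_derivative_iff)
  moreover have "l / 2 * ((h q' - h q) / (q' - q)) / (1 + r q') = (b q' - b q) / (q' - q)" for q'
  proof -
    have "l / 2 * ((h q' - h q) / (q' - q)) / (1 + r q') = (l / 2 * (h q' - h q)) / (1 + r q') / (q' - q)"
      by (simp only: times_divide_eq_right divide_divide_eq_left mult.assoc mult.commute mult.left_commute)
    also have "\<dots> = (b q' - b q) / (q' - q)"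
      unfolding diff[symmetric] using r[of q'] by simp
    finally show ?thesis .
  qed
  ultimately have "(b has_real_derivative l / 2 * D / (1 + r q)) (at q within S)"
    by (simp add: has_field_derivative_iff)
  then show ?thesis using r[of q] unfolding b_def by blast
qed

subsection \<open>Payoffs\<close>

text \<open>The fixed-point equation eliminates the critical level, so the experiment matters only
  through effort.\<close>

lemma equilibrium_payoff_J_eq:
  fixes \<pi> :: "'w::finite info"
  assumes "0 \<le> i" "i < 1" "0 < l" "l < 1"
  shows "equilibrium_payoff_J X I i l \<pi> = U_J X I (effort_J i l \<pi>) (2 * effort_J i l \<pi> / l)"
proof -
  have "critical_verification i \<pi> (effort_J i l \<pi>) = 2 * effort_J i l \<pi> / l"
    using effort_J_equation(3)[OF assms, of \<pi>] assms by (simp add: field_simps)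
  then show ?thesis by (simp add: equilibrium_payoff_J_def)
qed

text \<open>The expected loss is proportional to \<open>(1 - b) * (1 - b / l)\<close>, whose factors
  are positive and decreasing for \<open>b < l\<close>.\<close>

lemma U_J_strict_mono_effort:
  assumes "0 < l" "l < 1" "0 < I" "b < b'" "b' < l"
  shows "U_J X I b (2 * b / l) < U_J X I b' (2 * b' / l)"
proof -
  have "(1 - b') * (1 - b' / l) < (1 - b) * (1 - b / l)"
    using assms by (intro mult_strict_mono) (auto simp: divide_strict_right_mono)
  then have "(1 - b') * (1 - b' / l) * I < (1 - b) * (1 - b / l) * I" using assms by simp
  then show ?thesis unfolding U_J_def by simp
qed

lemma has_real_derivative_U_J_effort:
  assumes "l \<noteq> 0"
  shows "((\<lambda>b. U_J X I b (2 * b / l)) has_real_derivative 1/2 * I * ((1 - b / l) + (1 - b) / l)) (at b)"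
  unfolding U_J_def
  by (rule derivative_eq_intros refl | use assms in \<open>simp add: field_simps\<close>)+

text \<open>A maximiser exists on the compact interval \<open>[0, 1]\<close>, and a negative
  derivative at 1 rules out that endpoint; hence \<open>ARG_MAX\<close> picks a true
  maximiser.\<close>

lemma verification_C_maximal:
  assumes I: "0 < I" "I < c" and l: "0 < l" "l < 1"
  shows "is_arg_max (\<lambda>a. U_C X I c (best_response_C l a) a) (\<lambda>a. 0 \<le> a \<and> a < 1) (verification_C X I c l)"
proof -
  define W where "W a = U_C X I c (best_response_C l a) a" for a
  have "continuous_on {0..1} W"
    unfolding W_def U_C_def best_response_C_def by (intro continuous_intros) auto
  then obtain m where m: "m \<in> {0..1}" "\<And>a. a \<in> {0..1} \<Longrightarrow> W a \<le> W m"
    using continuous_attains_sup[of "{0..1}" W] by auto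
  have deriv: "(W has_real_derivative 1/2 * I * (1 - l / 2) - c + 3/8 * l * c) (at 1)"
    unfolding W_def U_C_def best_response_C_def
    by (rule derivative_eq_intros refl | simp add: field_simps)+
  have "1/2 * I * (1 - l / 2) - c + 3/8 * l * c \<le> 1/2 * c * (1 - l / 2) - c + 3/8 * l * c"
    using I l by simp
  also have "\<dots> = (l / 8 - 1/2) * c" by (simp add: field_simps)
  also have "\<dots> < 0" using I l by (intro mult_neg_pos) auto
  finally obtain d where d: "d > 0" "\<And>h. 0 < h \<Longrightarrow> h < d \<Longrightarrow> W 1 < W (1 - h)"
    using DERIV_neg_dec_left[OF deriv] by auto
  have "W 1 < W (1 - min (d / 2) 1)" using d by (intro d(2)) auto
  also have "\<dots> \<le> W m" using d(1) by (intro m(2)) auto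
  finally have "m \<noteq> 1" by auto
  then have "is_arg_max W (\<lambda>a. 0 \<le> a \<and> a < 1) m"
    using m by (auto simp: is_arg_max_linorder)
  then show ?thesis
    unfolding verification_C_def arg_max_def W_def by (rule someI)
qed

lemma equilibrium_payoff_C_maximal:
  assumes "0 < I" "I < c" "0 < l" "l < 1"
  shows "\<exists>a. 0 \<le> a \<and> a < 1 \<and> equilibrium_payoff_C X I c l = U_C X I c (l / 2 * a) a"
    and "0 \<le> a \<Longrightarrow> a < 1 \<Longrightarrow> U_C X I c (l / 2 * a) a \<le> equilibrium_payoff_C X I c l"
  using verification_C_maximal[OF assms, of X]
  unfolding equilibrium_payoff_C_def effort_C_def best_response_C_def is_arg_max_linorder by auto

section \<open>Comparison of the two regimes at the extremes of information\<close>

lemma payoff_C_gt_payoff_J_uninformative: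
  fixes \<pi> :: "'w::finite info"
  assumes I: "0 < I" "I < c" and l: "0 < l" "l < 1" and un: "uninformative \<pi>"
  shows "equilibrium_payoff_J X I (I / c) l \<pi> < equilibrium_payoff_C X I c l"
proof -
  define i where "i = I / c"
  have i: "0 < i" "i < 1" and c: "I = c * i" "c > 0" using I by (auto simp: i_def)
  define b where "b = effort_J i l \<pi>"
  define a where "a = critical_verification i \<pi> b"
  have b: "0 \<le> b" "b < 1" "b = l / 2 * a"
    using effort_J_equation[of i l \<pi>] i l unfolding b_def[symmetric] a_def by auto
  have a: "a = i * ((1 - b) / (2 - b))"
    unfolding a_def using un b by (simp add: critical_verification_eq_bad_belief bad_belief_uninformative)
  \<comment> \<open>The first-order condition of the stakeholder at given effort
    \<open>b\<close>.\<close>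
  have foc: "c * (a * (2 - b)) = I * (1 - b)"
  proof -
    have "2 - b \<noteq> 0" using b(2) by simp
    then have "a * (2 - b) = i * (1 - b)" unfolding a by simp
    then show ?thesis by (simp add: c(1))
  qed
  have a01: "0 < a" "a < 1"
  proof -
    show "0 < a" using b(1,2) i by (simp add: a)
    have "i * ((1 - b) / (2 - b)) < 1 * 1" using b i by (intro mult_strict_mono) auto
    then show "a < 1" using a by simp
  qed
  define W where "W a = U_C X I c (l / 2 * a) a" for a
  define W' where "W' = l / 2 * (1/2 * (1 - a) * I + 1/4 * c * a\<^sup>2)"
  \<comment> \<open>The first summand is the effect through the auditor's effort, the second the
    direct effect at fixed effort, which vanishes by \<open>foc\<close>.\<close>
  have "(W has_real_derivative (l / 2 * (1/2 * (1 - a) * I + 1/4 * c * a\<^sup>2) +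
      1/2 * (I * (1 - l / 2 * a) - c * (a * (2 - l / 2 * a))))) (at a)"
    unfolding W_def U_C_def
    by (rule derivative_eq_intros refl | simp add: field_simps power2_eq_square)+
  then have deriv: "(W has_real_derivative W') (at a)"
    unfolding W'_def b(3)[symmetric] foc by simp
  have "W' > 0" unfolding W'_def using a01 I l c by (intro mult_pos_pos add_pos_pos) auto
  then obtain d where d: "d > 0" "\<And>h. 0 < h \<Longrightarrow> h < d \<Longrightarrow> W a < W (a + h)"
    using DERIV_pos_inc_right[OF deriv] by auto
  define h where "h = min (d / 2) ((1 - a) / 2)"
  have h: "0 < h" "h < d" "a + h < 1" using d(1) a01 by (auto simp: h_def min_def field_simps)
  \<comment> \<open>By \<open>foc\<close> the expected verification cost is half the expected saving
    from verification, which turns \<open>U_C\<close> into \<open>U_J\<close>.\<close>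
  have "c * a\<^sup>2 * (2 - b) = I * (1 - b) * a"
    unfolding foc[symmetric] by (simp add: power2_eq_square)
  then have "U_J X I b a = U_C X I c b a"
    unfolding U_J_def U_C_def by (simp add: field_simps)
  then have "equilibrium_payoff_J X I i l \<pi> = W a"
    unfolding equilibrium_payoff_J_def W_def b_def[symmetric] a_def[symmetric] b(3)[symmetric] .
  also have "\<dots> < W (a + h)" using h d by blast
  also have "\<dots> \<le> equilibrium_payoff_C X I c l"
    unfolding W_def using h a01 I l by (intro equilibrium_payoff_C_maximal) auto
  finally show ?thesis by (simp add: i_def)
qed

lemma payoff_C_less_payoff_J_perfectly_informative:
  fixes \<pi> :: "'w::finite info"
  assumes I: "0 < I" "I < c" and l: "0 < l" "l < 1" and perf: "perfectly_informative \<pi>"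
  shows "equilibrium_payoff_C X I c l < equilibrium_payoff_J X I (I / c) l \<pi>"
proof -
  define i where "i = I / c"
  have i: "0 < i" "i < 1" and c: "I = c * i" "c > 0" using I by (auto simp: i_def)
  define b where "b = effort_J i l \<pi>"
  have e: "0 \<le> b" "b < 1" "l / 2 * critical_verification i \<pi> b = b"
    using effort_J_equation[of i l \<pi>] i l unfolding b_def by auto
  then have crit: "critical_verification i \<pi> b = i"
    using perf by (simp add: critical_verification_eq_bad_belief bad_belief_perfectly_informative)
  then have J: "equilibrium_payoff_J X I i l \<pi> = U_J X I (l / 2 * i) i"
    unfolding equilibrium_payoff_J_def b_def[symmetric] using e by simp
  obtain a where a: "0 \<le> a" "a < 1" and C: "equilibrium_payoff_C X I c l = U_C X I c (l / 2 * a) a"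
    using equilibrium_payoff_C_maximal(1)[of I c l X] I l by blast
  \<comment> \<open>Only for \<open>a > i\<close> is the first term negative; then its size is at
    most \<open>i * (a - i)\<close>, which is below \<open>a\<^sup>2\<close>.\<close>
  have "i * (1 - i / 2) * l * (i - a) + a\<^sup>2 > 0"
  proof (cases "a \<le> i")
    case True
    then have "i * (1 - i / 2) * l * (i - a) \<ge> 0" using i l by simp
    moreover have "i * (1 - i / 2) * l * (i - a) > 0" if "a = 0" using i l that by simp
    ultimately show ?thesis by (cases "a = 0") (auto intro: add_nonneg_pos)
  next
    case False
    have "i * (1 - i / 2) * l \<le> i" using i l
      by (simp add: mult_left_le mult_le_one mult.assoc)
    then have "i * (1 - i / 2) * l * (a - i) \<le> i * (a - i)"
      using False by (intro mult_right_mono) auto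
    also have "\<dots> < a * a" using False i by (intro mult_strict_mono) auto
    finally show ?thesis by (simp add: power2_eq_square field_simps)
  qed
  moreover have "(1 - l / 2 * a) * (a - i)\<^sup>2 \<ge> 0"
  proof -
    have "l * a \<le> 1 * 1" using a l by (intro mult_mono) auto
    then show ?thesis by simp
  qed
  ultimately have "c / 4 * (i * (1 - i / 2) * l * (i - a) + a\<^sup>2 + (1 - l / 2 * a) * (a - i)\<^sup>2) > 0"
    using c by simp
  moreover have "U_J X I (l / 2 * i) i - U_C X I c (l / 2 * a) a =
      c / 4 * (i * (1 - i / 2) * l * (i - a) + a\<^sup>2 + (1 - l / 2 * a) * (a - i)\<^sup>2)"
    unfolding U_J_def U_C_def c(1) by (simp add: field_simps power2_eq_square)
  ultimately show ?thesis using J C by (simp add: i_def)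
qed

theorem lemma1:
  fixes X I c k L i l :: real
    and \<pi> :: "real \<Rightarrow> 'w::finite info"
  assumes "X > 0" and "X / 2 > I"
    and "c > I" and "I > 0"
    and "k > L" and "L > 0"
    and "i = I / c" and "l = L / k"
    and "continuous_nested_family \<pi>"
  shows "equilibrium_payoff_C X I c l > equilibrium_payoff_J X I i l (\<pi> 0) \<and>
    (strict_mono_on {0..1} (\<lambda>q. equilibrium_payoff_J X I i l (\<pi> q)) \<and>
     (\<forall>q\<in>{0..1}. \<forall>D.
        ((\<lambda>q'. critical_verification i (\<pi> q') (effort_J i l (\<pi> q))) has_real_derivative D)
          (at q within {0..1}) \<and> D \<noteq> 0 \<longrightarrow>
        (\<exists>D'>0. ((\<lambda>q'. equilibrium_payoff_J X I i l (\<pi> q')) has_real_derivative D')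
          (at q within {0..1})))) \<and>
    equilibrium_payoff_C X I c l < equilibrium_payoff_J X I i l (\<pi> 1)"
proof -
  have i: "0 < i" "i < 1" and l: "0 < l" "l < 1" using assms by simp_all
  have dom: "strictly_blackwell_dominates (\<pi> q') (\<pi> q)"
    if "q \<in> {0..1}" "q' \<in> {0..1}" "q < q'" for q q'
    using assms(9) that unfolding continuous_nested_family_def by blast
  have un: "uninformative (\<pi> 0)" and perf: "perfectly_informative (\<pi> 1)"
    and cont: "\<And>\<theta> \<omega>. continuous_on {0..1} (\<lambda>q. pmf (\<pi> q \<theta>) \<omega>)"
    using assms(9) unfolding continuous_nested_family_def by auto
  have J: "equilibrium_payoff_J X I i l \<rho> = U_J X I (effort_J i l \<rho>) (2 * effort_J i l \<rho> / l)"
    for \<rho> :: "'w info"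
    using i l by (intro equilibrium_payoff_J_eq) auto
  have eff: "effort_J i l \<rho> < l" "effort_J i l \<rho> < 1" for \<rho> :: "'w info"
  proof -
    have "l * i < l * 2" using i l by simp
    then show "effort_J i l \<rho> < l" using effort_J_le[of i l \<rho>] i l by linarith
    then show "effort_J i l \<rho> < 1" using l by simp
  qed
  have mono: "strict_mono_on {0..1} (\<lambda>q. equilibrium_payoff_J X I i l (\<pi> q))"
    unfolding J using i l dom eff assms(4)
    by (intro strict_mono_onI U_J_strict_mono_effort effort_J_strict_mono_blackwell) auto
  have deriv: "\<exists>D'>0. ((\<lambda>q'. equilibrium_payoff_J X I i l (\<pi> q')) has_real_derivative D')
      (at q within {0..1})"
    if q: "q \<in> {0..1}" and "D \<noteq> 0" and
      D: "((\<lambda>q'. critical_verification i (\<pi> q') (effort_J i l (\<pi> q))) has_real_derivative D)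
        (at q within {0..1})" for q D
  proof -
    define b where "b = effort_J i l (\<pi> q)"
    define h where "h q' = critical_verification i (\<pi> q') b" for q'
    have h_mono: "h x < h y" if "x \<in> {0..1}" "y \<in> {0..1}" "x < y" for x y
      using bad_belief_strict_mono_blackwell[OF dom[OF that], of "1 - b"] i eff
      by (simp add: h_def b_def critical_verification_eq_bad_belief)
    \<comment> \<open>Difference quotients of the increasing \<open>h\<close> are nonnegative, so
      the nonzero \<open>D\<close> is positive.\<close>
    have "((\<lambda>y. (h y - h q) / (y - q)) \<longlongrightarrow> D) (at q within {0..1})"
      using D unfolding h_def b_def by (simp add: has_field_derivative_iff)
    moreover have "\<forall>\<^sub>F y in at q within {0..1}. 0 \<le> (h y - h q) / (y - q)"
    proof -
      have "0 \<le> (h y - h q) / (y - q)" if "y \<in> {0..1}" for y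
        using h_mono[OF that q] h_mono[OF q that]
        by (cases y q rule: linorder_cases) (auto intro: divide_nonneg_nonneg divide_nonpos_nonpos)
      then show ?thesis by (auto simp: eventually_at_filter)
    qed
    moreover have "at q within {0..1} \<noteq> bot"
        using q by (simp add: trivial_limit_within)
    ultimately have "D \<ge> 0" using tendsto_lowerbound by blast
    then have "D > 0" using \<open>D \<noteq> 0\<close> by simp
    obtain s where s: "s \<ge> 0"
      "((\<lambda>q'. effort_J i l (\<pi> q')) has_real_derivative l / 2 * D / (1 + s)) (at q within {0..1})"
      using has_real_derivative_effort_J[OF i l q cont D] by blast
    \<comment> \<open>The derivative of the payoff in effort, for the chain rule.\<close>
    define u where "u = 1/2 * I * ((1 - b / l) + (1 - b) / l)"
    have "b < l" "b < 1" using eff by (simp_all add: b_def)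
    then have "u > 0" unfolding u_def using l assms(4) by (intro mult_pos_pos add_pos_pos) auto
    then have "u * (l / 2 * D / (1 + s)) > 0" using \<open>D > 0\<close> l s(1) by simp
    moreover have "((\<lambda>q'. equilibrium_payoff_J X I i l (\<pi> q')) has_real_derivative
        u * (l / 2 * D / (1 + s))) (at q within {0..1})"
      unfolding J u_def b_def using l
      by (intro DERIV_chain2[OF _ s(2)] has_real_derivative_U_J_effort) auto
    ultimately show ?thesis by blast
  qed
  show ?thesis
    using payoff_C_gt_payoff_J_uninformative[OF assms(4,3) l un, of X]
      payoff_C_less_payoff_J_perfectly_informative[OF assms(4,3) l perf, of X] mono deriv
    unfolding assms(7)[symmetric] by blast
qed

end
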